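(* Despite the influence of the reward model (that is, assuming an ideal reward model, $\epsilon_k=1$ for all $k$), the minimal $N$ for making Best-of-N (BoN) obtain a probability of correct reasoning comparable to that of Monte Carlo Tree Search (MCTS) in the worst case is $$N_{\min}^{\mathrm{worst}}=O\!\left(b^{\frac{L}{2}}\right).$$ Here the comparison is made between the upper bounds on the probability of a $\tau$-correct response of the two methods, namely $\epsilon_N N^L\lambda_\tau^L e^{-\frac{L(L+1)}{2}}$ for BoN and $\lambda_\tau^L\left(\frac{e}{b}\right)^{-\frac{L(L+1)}{2}}\prod_{l=1}^L\epsilon_{b^l}$ for MCTS in the worst case.
   Context: A response $\mathcal R=[r_1,\dots,r_L]$ is a sequence of $L$ reasoning steps. Given a real-valued oracle $\phi$ and a golden step $r_l^*$ at each layer $l$, a response is $\tau$-correct if $|\phi(r_l)-\phi(r_l^* )|\le\tau$ for all $l$. $\lambda_\tau$ is a constant depending on $\tau$: a sampled step at layer $l$ is $\tau$-correct with probability $\min(\lambda_\tau e^{-l},1)$, given that the preceding step is $\tau$-correct. BoN generates $N$ reasoning paths of length $L$ and selects one of the $N$ with a reward model. MCTS expands $b$ child nodes per expansion and terminates once a reasoning path of length $L$ is derived; in the worst case it expands all possible child nodes at each step, building a complete $b$-ary search tree terminating at the $L$-th layer. $\epsilon_k$ is the probability of selecting a $\tau$-correct step from $k$ candidates; an ideal reward model ensures that whenever at least one correct candidate exists, $\epsilon_k=1$ for all $k$. *)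

theory Defs
  imports Complex_Main "HOL-Library.Landau_Symbols"
begin

text \<open>
  Parameters: \<open>eps k\<close> is the probability that the reward model selects a correct step out of
  \<open>k\<close> candidates; \<open>lam\<close> is the constant \<open>\<lambda>\<^sub>\<tau>\<close> for which a step sampled at layer \<open>l\<close> after a
  correct step is correct with probability \<open>min (lam * exp (- l)) 1\<close>; \<open>L\<close> is the number of
  layers; \<open>N\<close> is the number of sampled paths and \<open>b\<close> the branching factor.
\<close>

definition ideal_reward_model :: "(nat \<Rightarrow> real) \<Rightarrow> bool" where
  "ideal_reward_model eps \<longleftrightarrow> (\<forall>k\<ge>1. eps k = 1)"

text \<open>
  The upper bounds on the probability of a correct response. Selecting out of the \<open>N\<close> finished
  paths contributes one factor \<open>eps N\<close>; the complete \<open>b\<close>-ary tree has \<open>b ^ l\<close> candidates at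
  layer \<open>l\<close> and contributes a factor \<open>eps (b ^ l)\<close> for each layer.
\<close>

definition bon_bound :: "(nat \<Rightarrow> real) \<Rightarrow> real \<Rightarrow> nat \<Rightarrow> nat \<Rightarrow> real" where
  "bon_bound eps lam N L =
     eps N * real N ^ L * lam ^ L * exp (- (real L * (real L + 1) / 2))"

definition mcts_worst_bound :: "(nat \<Rightarrow> real) \<Rightarrow> real \<Rightarrow> nat \<Rightarrow> nat \<Rightarrow> real" where
  "mcts_worst_bound eps lam b L =
     lam ^ L * (exp 1 / real b) powr (- (real L * (real L + 1) / 2)) * (\<Prod>l=1..L. eps (b ^ l))"

definition bon_matches_mcts_worst ::
    "(nat \<Rightarrow> real) \<Rightarrow> real \<Rightarrow> nat \<Rightarrow> nat \<Rightarrow> nat \<Rightarrow> bool" where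
  "bon_matches_mcts_worst eps lam b L N \<longleftrightarrow>
     N \<ge> 1 \<and> bon_bound eps lam N L \<ge> mcts_worst_bound eps lam b L"

definition N_min_worst :: "(nat \<Rightarrow> real) \<Rightarrow> real \<Rightarrow> nat \<Rightarrow> nat \<Rightarrow> nat" where
  "N_min_worst eps lam b L = (LEAST N. bon_matches_mcts_worst eps lam b L N)"

text \<open>The minimum is taken over a nonempty set, so \<open>LEAST\<close> denotes a genuine minimum.\<close>

lemma bon_matches_mcts_worst_exists:
  assumes "ideal_reward_model eps" "lam \<ge> 0" "b \<ge> 1"
  shows "\<exists>N. bon_matches_mcts_worst eps lam b L N"
proof
  define x where "x = real L * (real L + 1) / 2"
  have eps: "eps k = 1" if "k \<ge> 1" for k
    using assms(1) that by (simp add: ideal_reward_model_def)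
  have b: "real b \<ge> 1" using assms(3) by simp
  have pos: "b ^ m \<ge> 1" for m using assms(3) by simp
  have "(exp 1 / real b) powr (- x) = real b powr x * exp (- x)"
    using b by (simp add: powr_divide powr_minus exp_minus field_simps)
      (simp add: powr_def)
  also have "\<dots> \<le> real b powr (2 * x) * exp (- x)"
    using b by (intro mult_right_mono powr_mono) (auto simp: x_def)
  also have "real b powr (2 * x) = real (b ^ (L + 1)) ^ L"
  proof -
    have "2 * x = real ((L + 1) * L)" by (simp add: x_def algebra_simps)
    then show ?thesis using b by (simp only: powr_realpow of_nat_power power_mult)
  qed
  finally have le: "(exp 1 / real b) powr (- x) \<le> real (b ^ (L + 1)) ^ L * exp (- x)" .
  have "lam ^ L * (exp 1 / real b) powr (- x) \<le> lam ^ L * (real (b ^ (L + 1)) ^ L * exp (- x))"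
    using le assms(2) by (intro mult_left_mono) auto
  then show "bon_matches_mcts_worst eps lam b L (b ^ (L + 1))"
    using eps pos[of "L + 1"] pos
    by (simp add: bon_matches_mcts_worst_def bon_bound_def mcts_worst_bound_def x_def mult_ac)
qed

end

theory Submission
  imports Defs
begin

text \<open>
  With an ideal reward model the factors \<open>lam ^ L * exp (- L (L + 1) / 2)\<close> cancel, so BoN matches
  MCTS as soon as \<open>N ^ L \<ge> b powr (L (L + 1) / 2)\<close>, that is \<open>N \<ge> b powr ((L + 1) / 2)\<close>. Rounding
  up costs at most \<open>1 \<le> b powr (L / 2)\<close>, which gives the constant \<open>b powr (1 / 2) + 1\<close>.
\<close>

lemma bon_matches_mcts_worstI:
  assumes "ideal_reward_model eps" "lam \<ge> 0" "b \<ge> 1"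
    and N: "real N \<ge> real b powr ((real L + 1) / 2)"
  shows "bon_matches_mcts_worst eps lam b L N"
proof -
  define x where "x = real L * (real L + 1) / 2"
  have eps: "eps k = 1" if "k \<ge> 1" for k
    using assms(1) that by (simp add: ideal_reward_model_def)
  have b: "real b > 0" and pos: "b ^ m \<ge> 1" for m using \<open>b \<ge> 1\<close> by simp_all
  \<comment> \<open>A positive threshold forces \<open>N \<ge> 1\<close>, which the predicate
    demands and which yields \<open>eps N = 1\<close>; \<open>ideal_reward_model\<close> leaves
    \<open>eps 0\<close> open.\<close>
  have "0 < real b powr ((real L + 1) / 2)" using b by simp
  with N have "real N > 0" by linarith
  then have N1: "N \<ge> 1" by simp
  \<comment> \<open>Isolates the decay \<open>exp (- x)\<close> shared by both bounds, so only
    \<open>b powr x\<close> and \<open>N ^ L\<close> remain to be compared.\<close>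
  have "(exp 1 / real b) powr (- x) = real b powr x * exp (- x)"
    using b by (simp add: powr_def ln_div exp_add [symmetric] algebra_simps)
  \<comment> \<open>\<open>x\<close> is \<open>L\<close> times the threshold exponent, which makes
    \<open>b powr x\<close> an exact \<open>L\<close>-th power, also for \<open>L = 0\<close>;
    comparing bases then suffices.\<close>
  also have "real b powr x = (real b powr ((real L + 1) / 2)) ^ L"
    using b by (simp add: powr_power x_def mult.commute)
  also have "\<dots> \<le> real N ^ L"
    by (intro power_mono N) simp
  finally have "(exp 1 / real b) powr (- x) \<le> real N ^ L * exp (- x)"
    by simp
  then have "lam ^ L * (exp 1 / real b) powr (- x) \<le> lam ^ L * (real N ^ L * exp (- x))"
    using \<open>lam \<ge> 0\<close> by (intro mult_left_mono) auto
  then show ?thesis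
    using eps N1 pos
    by (simp add: bon_matches_mcts_worst_def bon_bound_def mcts_worst_bound_def x_def mult_ac)
qed

text \<open>A least element lies below every witness, and the ceiling of the threshold is a
  witness.\<close>

lemma N_min_worst_le:
  assumes "ideal_reward_model eps" "lam \<ge> 0" "b \<ge> 1"
  shows "real (N_min_worst eps lam b L) \<le> real b powr ((real L + 1) / 2) + 1"
proof -
  define y where "y = real b powr ((real L + 1) / 2)"
  have "y \<ge> 0" by (simp add: y_def)
  have "bon_matches_mcts_worst eps lam b L (nat \<lceil>y\<rceil>)"
    using assms by (intro bon_matches_mcts_worstI) (simp_all add: y_def real_nat_ceiling_ge)
  then have "N_min_worst eps lam b L \<le> nat \<lceil>y\<rceil>"
    unfolding N_min_worst_def by (rule Least_le)
  then have "real (N_min_worst eps lam b L) \<le> real (nat \<lceil>y\<rceil>)" by simp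
  also have "\<dots> \<le> y + 1" using \<open>y \<ge> 0\<close> by linarith
  finally show ?thesis by (simp add: y_def)
qed

theorem corollary5p5:
  fixes eps :: "nat \<Rightarrow> real" and lam :: "real \<Rightarrow> real" and \<tau> :: real and b :: nat
  assumes "ideal_reward_model eps"
    and "lam \<tau> \<ge> 0"
    and "b \<ge> 1"
  shows "(\<lambda>L. real (N_min_worst eps (lam \<tau>) b L)) \<in> O(\<lambda>L. real b powr (real L / 2))"
proof (rule bigoI)
  show "eventually (\<lambda>L. norm (real (N_min_worst eps (lam \<tau>) b L))
      \<le> (real b powr (1 / 2) + 1) * norm (real b powr (real L / 2))) sequentially"
  proof (rule always_eventually, rule allI)
    fix L
    have "1 \<le> real b powr (real L / 2)"
      using \<open>b \<ge> 1\<close> by (intro ge_one_powr_ge_zero) simp_all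
    \<comment> \<open>The excess 1/2 in the exponent splits off as a factor that is constant in
      \<open>L\<close>, since \<open>b\<close> is fixed while \<open>L\<close> grows.\<close>
    moreover have "real b powr ((real L + 1) / 2) = real b powr (1 / 2) * real b powr (real L / 2)"
      by (simp add: powr_add [symmetric] add_divide_distrib add.commute)
    ultimately show "norm (real (N_min_worst eps (lam \<tau>) b L))
        \<le> (real b powr (1 / 2) + 1) * norm (real b powr (real L / 2))"
      using N_min_worst_le [of eps "lam \<tau>" b L, OF assms] by (simp add: distrib_right)
  qed
qed

end
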